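(* Let $Q\subset E$ be convex, $f:Q\to\mathbb{R}$ convex, $L>0$, $\delta_k\ge 0$ for $k\ge 0$, and suppose that for every $k\ge 0$ and every $y\in Q$ there is a $(\delta_k,L)$-model $\psi_{\delta_k}(\cdot,y)$ of $f$ at $y$ with respect to the norm $\|\cdot\|$, with approximate values $f_{\delta_k}(y)$. Let $d$ be $1$-strongly convex on $Q$ w.r.t. $\|\cdot\|$. Let $x_0\in Q$, $0<L_0\le L$, and let $x_*$ be a minimizer of $f$ on $Q$ nearest to $x_0$ in the sense that it minimizes $V[x_0](\cdot)$ among minimizers of $f$; assume $V[x_0](x_* )\le R^2$. Then for the sequences generated by the fast gradient method described in the context and every $N\ge 1$, $$f(x_N)-f(x_* )\le\frac{R^2}{A_N}+\frac{2\sum_{k=0}^{N-1}\delta_kA_{k+1}}{A_N}\le\frac{8LR^2}{(N+1)^2}+\frac{2\sum_{k=0}^{N-1}\delta_kA_{k+1}}{A_N},$$ where $A_k\ge\frac{(k+1)^2}{8L}$ for all $k\ge1$. Moreover, the total number of times the auxiliary minimization problem is solved during the first $N$ iterations, i.e. $\sum_{k=0}^{N-1}(i_k+1)$, is at most $4N+\log_2\frac{L}{L_0}$.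
   Context: $E$ is a finite-dimensional real vector space with norm $\|\cdot\|$. $d$ is a convex differentiable function on $Q$ and $V[y](x)=d(x)-d(y)-\langle\nabla d(y),x-y\rangle$. Model. For $\delta\ge 0$, $L>0$, $\psi_\delta(x,y)$ is a $(\delta,L)$-model of $f$ at $y\in Q$ w.r.t. $\|\cdot\|$ if there is a number $f_\delta(y)\in[f(y)-\delta,f(y)]$ such that for all $x\in Q$ $$0\le f(x)-\bigl(f_\delta(y)+\psi_\delta(x,y)\bigr)\le \tfrac L2\|x-y\|^2+\delta,$$ $\psi_\delta(x,y)$ is convex in $x\in Q$, and $\psi_\delta(x,x)=0$ for all $x\in Q$. Fast gradient method. Put $y_0=u_0=x_0$, $\alpha_0=A_0=0$. For $k=0,1,2,\dots$: find the smallest integer $i_k\ge0$ such that, with $L_{k+1}=2^{i_k-1}L_k$, $\alpha_{k+1}$ the largest root of $A_k+\alpha_{k+1}=L_{k+1}\alpha_{k+1}^2$, $A_{k+1}=A_k+\alpha_{k+1}$, $$y_{k+1}=\frac{\alpha_{k+1}u_k+A_kx_k}{A_{k+1}},\quad u_{k+1}\in\arg\min_{x\in Q}L_{k+1}\bigl(V[u_k](x)+\alpha_{k+1}\psi_{\delta_k}(x,y_{k+1})\bigr),\quad x_{k+1}=\frac{\alpha_{k+1}u_{k+1}+A_kx_k}{A_{k+1}},$$ one has $$f_{\delta_k}(x_{k+1})\le f_{\delta_k}(y_{k+1})+\psi_{\delta_k}(x_{k+1},y_{k+1})+\tfrac{L_{k+1}}2\|x_{k+1}-y_{k+1}\|^2+\delta_k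 .$$ The minimization defining $u_{k+1}$ is the auxiliary problem (its minimizers are assumed to exist); each trial value $0,1,\dots,i_k$ requires solving it once. *)

theory Defs
  imports "HOL-Analysis.Analysis"
begin

definition strongly_convex_on :: "'a::real_normed_vector set \<Rightarrow> real \<Rightarrow> ('a \<Rightarrow> real) \<Rightarrow> bool" where
  "strongly_convex_on Q m d \<longleftrightarrow> convex Q \<and>
     (\<forall>x\<in>Q. \<forall>y\<in>Q. \<forall>t\<in>{0..1}.
        d ((1 - t) *\<^sub>R x + t *\<^sub>R y)
          \<le> (1 - t) * d x + t * d y - m / 2 * t * (1 - t) * (norm (x - y))\<^sup>2)"

text \<open>
  The Bregman divergence \<open>V[y](x)\<close> is \<open>bregman Q d y x\<close>. The derivative is taken within \<open>Q\<close>,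
  which may have empty interior, so as a functional it need not be unique. For convex \<open>Q\<close> and
  \<open>x, y \<in> Q\<close> its value at \<open>x - y\<close> is still determined, being the one-sided derivative of \<open>d\<close>
  at \<open>y\<close> along the segment from \<open>y\<close> to \<open>x\<close>.
\<close>
definition bregman :: "'a::real_normed_vector set \<Rightarrow> ('a \<Rightarrow> real) \<Rightarrow> 'a \<Rightarrow> 'a \<Rightarrow> real" where
  "bregman Q d y x = d x - d y - frechet_derivative d (at y within Q) (x - y)"

text \<open>
  \<open>\<psi>\<close> is a \<open>(\<delta>, L)\<close>-model of \<open>f\<close> at \<open>y\<close> whose approximate function value \<open>f\<^sub>\<delta>(y)\<close> is \<open>v\<close>.
  The number \<open>v\<close> is an argument because the fast gradient method evaluates it.
\<close>
definition inexact_model ::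
  "'a::real_normed_vector set \<Rightarrow> ('a \<Rightarrow> real) \<Rightarrow> real \<Rightarrow> real \<Rightarrow> ('a \<Rightarrow> 'a \<Rightarrow> real) \<Rightarrow> real \<Rightarrow> 'a \<Rightarrow> bool"
where
  "inexact_model Q f \<delta> L \<psi> v y \<longleftrightarrow>
     v \<in> {f y - \<delta>..f y} \<and>
     (\<forall>x\<in>Q. 0 \<le> f x - (v + \<psi> x y) \<and> f x - (v + \<psi> x y) \<le> L / 2 * (norm (x - y))\<^sup>2 + \<delta>) \<and>
     convex_on Q (\<lambda>x. \<psi> x y) \<and>
     (\<forall>x\<in>Q. \<psi> x x = 0)"

text \<open>
  A run of the fast gradient method. The primed functions give the values computed in trial \<open>j\<close>
  of iteration \<open>k\<close>, that is, with \<open>i\<^sub>k\<close> replaced by \<open>j\<close>; \<open>w k j\<close> is the chosen solution of the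
  auxiliary problem in that trial. It is required to exist only for trials that are reached,
  i.e. all of whose predecessors failed the acceptance test. That some trial passes the test, so
  that the \<open>LEAST\<close> below is meaningful, is not part of the definition. The sequence \<open>M\<close> is
  \<open>L\<^sub>0, L\<^sub>1, \<dots>\<close>, and \<open>fd k\<close> is the approximate value \<open>f\<^sub>\<delta>\<close> for \<open>\<delta> = \<delta>\<^sub>k\<close>.
\<close>
definition fast_gradient_run ::
  "'a::real_normed_vector set \<Rightarrow> ('a \<Rightarrow> real) \<Rightarrow> (nat \<Rightarrow> real) \<Rightarrow> (nat \<Rightarrow> 'a \<Rightarrow> 'a \<Rightarrow> real) \<Rightarrow>
   (nat \<Rightarrow> 'a \<Rightarrow> real) \<Rightarrow> 'a \<Rightarrow> real \<Rightarrow>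
   (nat \<Rightarrow> 'a) \<Rightarrow> (nat \<Rightarrow> 'a) \<Rightarrow> (nat \<Rightarrow> 'a) \<Rightarrow> (nat \<Rightarrow> real) \<Rightarrow> (nat \<Rightarrow> real) \<Rightarrow> (nat \<Rightarrow> real) \<Rightarrow>
   (nat \<Rightarrow> nat) \<Rightarrow> (nat \<Rightarrow> nat \<Rightarrow> 'a) \<Rightarrow> bool"
where
  "fast_gradient_run Q d \<delta> \<psi> fd x0 L0 x y u \<alpha> A M i w \<longleftrightarrow>
     x 0 = x0 \<and> y 0 = x0 \<and> u 0 = x0 \<and> \<alpha> 0 = 0 \<and> A 0 = 0 \<and> M 0 = L0 \<and>
     (\<forall>k.
       let L' = (\<lambda>j. 2 powi (int j - 1) * M k);
           \<alpha>' = (\<lambda>j. GREATEST a. A k + a = L' j * a\<^sup>2);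
           A' = (\<lambda>j. A k + \<alpha>' j);
           y' = (\<lambda>j. (\<alpha>' j *\<^sub>R u k + A k *\<^sub>R x k) /\<^sub>R A' j);
           u' = w k;
           x' = (\<lambda>j. (\<alpha>' j *\<^sub>R u' j + A k *\<^sub>R x k) /\<^sub>R A' j);
           accepted = (\<lambda>j. fd k (x' j) \<le> fd k (y' j) + \<psi> k (x' j) (y' j)
                             + L' j / 2 * (norm (x' j - y' j))\<^sup>2 + \<delta> k)
       in (\<forall>j. (\<forall>m<j. \<not> accepted m) \<longrightarrow>
             is_arg_min (\<lambda>v. L' j * (bregman Q d (u k) v + \<alpha>' j * \<psi> k v (y' j))) (\<lambda>v. v \<in> Q) (u' j)) \<and>
          i k = (LEAST j. accepted j) \<and>
          M (Suc k) = L' (i k) \<and> \<alpha> (Suc k) = \<alpha>' (i k) \<and> A (Suc k) = A' (i k) \<and>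
          y (Suc k) = y' (i k) \<and> u (Suc k) = u' (i k) \<and> x (Suc k) = x' (i k))"

end

theory Submission
  imports Defs
begin

text \<open>
  Minimality of \<open>u (Suc k)\<close> gives the three-point inequality
  \<open>\<alpha> \<psi>(u\<^sub>k\<^sub>+\<^sub>1) + V[u\<^sub>k](u\<^sub>k\<^sub>+\<^sub>1) + V[u\<^sub>k\<^sub>+\<^sub>1](z) \<le> \<alpha> \<psi>(z) + V[u\<^sub>k](z)\<close>. Combined with the acceptance test,
  the convexity of the model, and \<open>V[u\<^sub>k](u\<^sub>k\<^sub>+\<^sub>1) \<ge> \<parallel>u\<^sub>k\<^sub>+\<^sub>1 - u\<^sub>k\<parallel>\<^sup>2 / 2\<close>, it shows that
  \<open>A\<^sub>k (f(x\<^sub>k) - f(z)) + V[u\<^sub>k](z)\<close> grows by at most \<open>2 \<delta>\<^sub>k A\<^sub>k\<^sub>+\<^sub>1\<close> per iteration. A trial with constant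
  at least \<open>L\<close> is always accepted, so \<open>L\<^sub>k \<le> 2L\<close>; this bounds the increments of \<open>sqrt A\<^sub>k\<close> from below and,
  by telescoping \<open>i\<^sub>k + 1 = 2 + log 2 (L\<^sub>k\<^sub>+\<^sub>1 / L\<^sub>k)\<close>, the number of trials.
\<close>

section \<open>One-sided derivatives and Bregman divergences on a convex set\<close>

lemma tendsto_directional_derivative_within:
  fixes d :: "'a::real_normed_vector \<Rightarrow> real"
  assumes Q: "convex Q" "y \<in> Q" "x \<in> Q"
    and D: "(d has_derivative D) (at y within Q)"
  shows "((\<lambda>t. (d ((1 - t) *\<^sub>R y + t *\<^sub>R x) - d y) / t) \<longlongrightarrow> D (x - y)) (at_right 0)"
proof -
  let ?g = "\<lambda>t::real. (1 - t) *\<^sub>R y + t *\<^sub>R x"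
  have g: "(?g has_derivative (\<lambda>t. t *\<^sub>R (x - y))) (at 0 within {0..1})"
    by (auto intro!: derivative_eq_intros simp: algebra_simps)
  have sub: "?g ` {0..1} \<subseteq> Q"
    using Q by (auto simp: convex_alt)
  \<comment> \<open>Convexity keeps the segment inside \<open>Q\<close>, so a derivative taken only
    within \<open>Q\<close> still obeys the chain rule along it.\<close>
  have D': "(d has_derivative D) (at (?g 0) within ?g ` {0..1})"
    using has_derivative_subset[OF D sub] by simp
  have "((\<lambda>t. d (?g t)) has_derivative (\<lambda>t. D (t *\<^sub>R (x - y)))) (at 0 within {0..1})"
    using has_derivative_in_compose[OF g D'] .
  moreover have "(\<lambda>t. D (t *\<^sub>R (x - y))) = (\<lambda>t. t * D (x - y))"
    using has_derivative_linear[OF D] by (auto simp: linear_cmul)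
  ultimately have "((\<lambda>t. d (?g t)) has_field_derivative D (x - y)) (at 0 within {0..1})"
    by (simp add: has_field_derivative_def mult.commute[of _ "D (x - y)"])
  then have "((\<lambda>t. (d (?g t) - d y) / t) \<longlongrightarrow> D (x - y)) (at 0 within {0..1})"
    by (simp add: has_field_derivative_iff)
  then show ?thesis
    by (simp add: at_within_Icc_at_right)
qed

text \<open>Strong convexity along the segment from \<open>y\<close> to \<open>x\<close>, divided by
  \<open>t\<close>, bounds the difference quotient of \<open>d\<close>; as \<open>t\<close> tends to
  0 from the right, the factor \<open>1 - t\<close> tends to 1.\<close>

lemma bregman_ge_half_norm_sq:
  fixes d :: "'a::real_normed_vector \<Rightarrow> real"
  assumes d: "d differentiable_on Q" "strongly_convex_on Q 1 d"
    and Q: "y \<in> Q" "x \<in> Q"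
  shows "(norm (x - y))\<^sup>2 / 2 \<le> bregman Q d y x"
proof -
  let ?D = "frechet_derivative d (at y within Q)"
  let ?g = "\<lambda>t::real. (1 - t) *\<^sub>R y + t *\<^sub>R x"
  let ?n = "(norm (x - y))\<^sup>2"
  have cQ: "convex Q" using d(2) by (simp add: strongly_convex_on_def)
  have D: "(d has_derivative ?D) (at y within Q)"
    using d(1) Q(1) by (simp add: differentiable_on_def frechet_derivative_works)
  have lim: "((\<lambda>t. (d (?g t) - d y) / t) \<longlongrightarrow> ?D (x - y)) (at_right 0)"
    by (rule tendsto_directional_derivative_within[OF cQ Q D])
  have lim': "((\<lambda>t. d x - d y - (1 - t) * ?n / 2) \<longlongrightarrow> d x - d y - (1 - 0) * ?n / 2) (at_right 0)"
    by (intro tendsto_intros) auto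
  have "eventually (\<lambda>t. (d (?g t) - d y) / t \<le> d x - d y - (1 - t) * ?n / 2) (at_right (0::real))"
    unfolding eventually_at_right_field
  proof (intro exI[of _ 1] conjI allI impI)
    fix t :: real assume t: "0 < t" "t < 1"
    have "d (?g t) \<le> (1 - t) * d y + t * d x - 1 / 2 * t * (1 - t) * (norm (y - x))\<^sup>2"
      using d(2) Q t unfolding strongly_convex_on_def by auto
    then have "d (?g t) - d y \<le> t * (d x - d y - (1 - t) * ?n / 2)"
      by (simp add: algebra_simps norm_minus_commute)
    then show "(d (?g t) - d y) / t \<le> d x - d y - (1 - t) * ?n / 2"
      using t by (simp add: divide_le_eq mult.commute)
  qed simp
  from tendsto_le[OF _ lim' lim this] show ?thesis
    by (simp add: bregman_def)
qed

text \<open>First-order optimality of \<open>u'\<close> in the direction of \<open>z\<close>,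
  followed by the identity relating three divergences. The function \<open>\<psi>\<close> is only
  convex, so its increment along the segment is bounded by convexity and only \<open>d\<close> is
  differentiated.\<close>

lemma bregman_three_point:
  fixes d \<psi> :: "'a::real_normed_vector \<Rightarrow> real"
  assumes d: "d differentiable_on Q" and \<psi>: "convex_on Q \<psi>"
    and Q: "u \<in> Q" "z \<in> Q" and c: "0 < c" and a: "0 \<le> a"
    and min: "is_arg_min (\<lambda>v. c * (bregman Q d u v + a * \<psi> v)) (\<lambda>v. v \<in> Q) u'"
  shows "a * \<psi> u' + bregman Q d u u' + bregman Q d u' z \<le> a * \<psi> z + bregman Q d u z"
proof -
  let ?D = "\<lambda>y. frechet_derivative d (at y within Q)"
  let ?g = "\<lambda>t::real. (1 - t) *\<^sub>R u' + t *\<^sub>R z"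
  have cQ: "convex Q" using \<psi> by (simp add: convex_on_def)
  have u': "u' \<in> Q" using min by (simp add: is_arg_min_def)
  have min': "bregman Q d u u' + a * \<psi> u' \<le> bregman Q d u v + a * \<psi> v" if "v \<in> Q" for v
    using min that c unfolding is_arg_min_def by (auto simp: not_less)
  have D: "(d has_derivative ?D y) (at y within Q)" if "y \<in> Q" for y
    using d that by (simp add: differentiable_on_def frechet_derivative_works)
  have lin: "linear (?D u)" using has_derivative_linear[OF D[OF Q(1)]] .
  have lim: "((\<lambda>t. (d (?g t) - d u') / t) \<longlongrightarrow> ?D u' (z - u')) (at_right 0)"
    by (rule tendsto_directional_derivative_within[OF cQ u' Q(2) D[OF u']])
  have "eventually (\<lambda>t. ?D u (z - u') - a * (\<psi> z - \<psi> u') \<le> (d (?g t) - d u') / t) (at_right (0::real))"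
    unfolding eventually_at_right_field
  proof (intro exI[of _ 1] conjI allI impI)
    fix t :: real assume t: "0 < t" "t < 1"
    have gQ: "?g t \<in> Q" using cQ u' Q(2) t by (auto simp: convex_alt)
    have "\<psi> (?g t) \<le> (1 - t) * \<psi> u' + t * \<psi> z"
      using \<psi> u' Q(2) t by (intro convex_onD) auto
    then have "a * \<psi> (?g t) \<le> a * ((1 - t) * \<psi> u' + t * \<psi> z)"
      using a by (rule mult_left_mono)
    moreover have "?D u (?g t - u) = ?D u (u' - u) + t * ?D u (z - u')"
    proof -
      have eq: "?g t - u = (u' - u) + t *\<^sub>R (z - u')" by (simp add: algebra_simps)
      show ?thesis unfolding eq using lin by (simp only: linear_add linear_cmul) simp
    qed
    ultimately have "t * (?D u (z - u') - a * (\<psi> z - \<psi> u')) \<le> d (?g t) - d u'"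
      using min'[OF gQ] by (simp add: bregman_def algebra_simps)
    then show "?D u (z - u') - a * (\<psi> z - \<psi> u') \<le> (d (?g t) - d u') / t"
      using t by (simp add: le_divide_eq mult.commute)
  qed simp
  from tendsto_lowerbound[OF lim this]
  have "?D u (z - u') - a * (\<psi> z - \<psi> u') \<le> ?D u' (z - u')" by simp
  moreover have "?D u (z - u) = ?D u (z - u') + ?D u (u' - u)"
    using linear_add[OF lin, of "z - u'" "u' - u"] by simp
  ultimately show ?thesis by (simp add: bregman_def algebra_simps)
qed

section \<open>One iteration: step size, accepted trial, change of the potential\<close>

lemma largest_step_root:
  fixes A l :: real
  assumes "0 \<le> A" "0 < l"
  defines "a \<equiv> GREATEST a. A + a = l * a\<^sup>2"
  shows "0 < a" "A + a = l * a\<^sup>2"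
proof -
  \<comment> \<open>The square root of the discriminant of l a^2 - a - A = 0; \<open>r\<close> is
    the larger root. Completing the square gives (2 l b - 1)^2 = s^2 for every root
    \<open>b\<close>, so \<open>r\<close> is a maximum and \<open>GREATEST\<close> denotes
    it.\<close>
  define s where "s = sqrt (1 + 4 * l * A)"
  define r where "r = (1 + s) / (2 * l)"
  have s: "s\<^sup>2 = 1 + 4 * l * A" "1 \<le> s" using assms(1,2) by (auto simp: s_def)
  have lr: "2 * l * r = 1 + s" using assms(2) by (simp add: r_def)
  have "4 * l * (l * r\<^sup>2) = (2 * l * r)\<^sup>2" by (simp add: power2_eq_square)
  also have "\<dots> = 2 * (2 * l * r) + 4 * l * A" unfolding lr by (simp add: power2_sum s(1))
  also have "\<dots> = 4 * l * (A + r)" by (simp add: algebra_simps)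
  finally have r: "A + r = l * r\<^sup>2" using assms(2) by simp
  have max: "b \<le> r" if "A + b = l * b\<^sup>2" for b
  proof -
    have "(2 * l * b - 1)\<^sup>2 = 1 + 4 * l * (l * b\<^sup>2 - b)"
      by (simp add: power2_eq_square algebra_simps)
    also have "\<dots> = s\<^sup>2" unfolding s(1) that[symmetric] by simp
    finally have "2 * l * b - 1 \<le> s"
      by (rule power2_le_imp_le[OF eq_refl]) (use s(2) in simp)
    then show ?thesis using assms(2) by (simp add: r_def field_simps)
  qed
  have "a = r" unfolding a_def using r max by (rule Greatest_equality)
  moreover have "0 < r" using s(2) assms(2) by (simp add: r_def)
  ultimately show "0 < a" "A + a = l * a\<^sup>2" using r by auto
qed

lemma weighted_mean_mem:
  fixes v w :: "'a::real_vector"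
  assumes "convex Q" "v \<in> Q" "w \<in> Q" "0 < a" "0 \<le> b"
  shows "(a *\<^sub>R v + b *\<^sub>R w) /\<^sub>R (b + a) \<in> Q"
proof -
  have "(a *\<^sub>R v + b *\<^sub>R w) /\<^sub>R (b + a) = (a / (b + a)) *\<^sub>R v + (b / (b + a)) *\<^sub>R w"
    by (simp add: scaleR_add_right divide_inverse mult.commute)
  also have "\<dots> \<in> Q"
    using assms by (intro convexD) (auto simp: add_divide_distrib[symmetric])
  finally show ?thesis .
qed

text \<open>Shows that the line search terminates, so that the \<open>LEAST\<close> in the
  definition of a run is attained, and collects what the accepted trial provides. Trial constants
  double, and once one reaches \<open>L\<close> the upper model inequality forces
  acceptance.\<close>

lemma fast_gradient_step:
  fixes Q :: "'a::real_normed_vector set"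
  assumes run: "fast_gradient_run Q d \<delta> \<psi> fd x0 L0 x y u \<alpha> A M i w"
    and Q: "convex Q"
    and model: "\<And>y. y \<in> Q \<Longrightarrow> inexact_model Q f (\<delta> k) L (\<psi> k) (fd k y) y"
    and xk: "x k \<in> Q" and uk: "u k \<in> Q" and Ak: "0 \<le> A k" and Mk: "0 < M k" "M k \<le> 2 * L"
  shows "M (Suc k) = 2 powi (int (i k) - 1) * M k" "0 < M (Suc k)" "M (Suc k) \<le> 2 * L"
    "0 < \<alpha> (Suc k)" "A (Suc k) = A k + \<alpha> (Suc k)" "A (Suc k) = M (Suc k) * (\<alpha> (Suc k))\<^sup>2"
    "y (Suc k) = (\<alpha> (Suc k) *\<^sub>R u k + A k *\<^sub>R x k) /\<^sub>R A (Suc k)"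
    "x (Suc k) = (\<alpha> (Suc k) *\<^sub>R u (Suc k) + A k *\<^sub>R x k) /\<^sub>R A (Suc k)"
    "is_arg_min (\<lambda>v. M (Suc k) * (bregman Q d (u k) v + \<alpha> (Suc k) * \<psi> k v (y (Suc k))))
       (\<lambda>v. v \<in> Q) (u (Suc k))"
    "x (Suc k) \<in> Q" "y (Suc k) \<in> Q" "u (Suc k) \<in> Q"
    "fd k (x (Suc k)) \<le> fd k (y (Suc k)) + \<psi> k (x (Suc k)) (y (Suc k))
       + M (Suc k) / 2 * (norm (x (Suc k) - y (Suc k)))\<^sup>2 + \<delta> k"
proof -
  define L' where "L' = (\<lambda>j. 2 powi (int j - 1) * M k)"
  define \<alpha>' where "\<alpha>' = (\<lambda>j. GREATEST a. A k + a = L' j * a\<^sup>2)"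
  define A' where "A' = (\<lambda>j. A k + \<alpha>' j)"
  define y' where "y' = (\<lambda>j. (\<alpha>' j *\<^sub>R u k + A k *\<^sub>R x k) /\<^sub>R A' j)"
  define x' where "x' = (\<lambda>j. (\<alpha>' j *\<^sub>R w k j + A k *\<^sub>R x k) /\<^sub>R A' j)"
  define acc where "acc = (\<lambda>j. fd k (x' j) \<le> fd k (y' j) + \<psi> k (x' j) (y' j)
      + L' j / 2 * (norm (x' j - y' j))\<^sup>2 + \<delta> k)"
  note defs = acc_def x'_def y'_def A'_def \<alpha>'_def L'_def
  have reached_min: "\<And>j. (\<forall>m<j. \<not> acc m) \<Longrightarrow>
      is_arg_min (\<lambda>v. L' j * (bregman Q d (u k) v + \<alpha>' j * \<psi> k v (y' j))) (\<lambda>v. v \<in> Q) (w k j)"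
    and ik: "i k = (LEAST j. acc j)"
    and new: "M (Suc k) = L' (i k)" "\<alpha> (Suc k) = \<alpha>' (i k)" "A (Suc k) = A' (i k)"
      "y (Suc k) = y' (i k)" "u (Suc k) = w k (i k)" "x (Suc k) = x' (i k)"
    using run unfolding fast_gradient_run_def Let_def defs by blast+
  have L'_pos: "0 < L' j" for j using Mk by (simp add: L'_def)
  have root: "0 < \<alpha>' j" "A k + \<alpha>' j = L' j * (\<alpha>' j)\<^sup>2" for j
    unfolding \<alpha>'_def using largest_step_root[OF Ak L'_pos] by auto
  have y'Q: "y' j \<in> Q" for j
    unfolding y'_def A'_def by (rule weighted_mean_mem[OF Q uk xk root(1) Ak])
  have wQ: "w k j \<in> Q" if "\<forall>m<j. \<not> acc m" for j
    using reached_min[OF that] by (simp add: is_arg_min_def)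
  have x'Q: "x' j \<in> Q" if "\<forall>m<j. \<not> acc m" for j
    unfolding x'_def A'_def by (rule weighted_mean_mem[OF Q wQ[OF that] xk root(1) Ak])
  \<comment> \<open>Restricted to reached trials: the auxiliary minimizer, and with it membership of
    \<open>x' j\<close> in \<open>Q\<close>, is guaranteed only there.\<close>
  have large: "acc j" if "\<forall>m<j. \<not> acc m" "L \<le> L' j" for j
  proof -
    have "fd k (x' j) \<le> f (x' j)"
      using model[OF x'Q[OF that(1)]] by (simp add: inexact_model_def)
    also have "\<dots> \<le> fd k (y' j) + \<psi> k (x' j) (y' j) + L / 2 * (norm (x' j - y' j))\<^sup>2 + \<delta> k"
      using model[OF y'Q[of j]] x'Q[OF that(1)] unfolding inexact_model_def by force
    also have "L / 2 * (norm (x' j - y' j))\<^sup>2 \<le> L' j / 2 * (norm (x' j - y' j))\<^sup>2"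
      using that(2) by (intro mult_right_mono) auto
    finally show ?thesis by (simp add: acc_def)
  qed
  have L'_Suc: "L' (Suc j) = 2 * L' j" for j
    by (simp add: L'_def power_int_diff)
  have "\<exists>j. acc j"
  proof (rule ccontr)
    assume none: "\<nexists>j. acc j"
    obtain j where "L / L' 0 < 2 ^ j"
      using real_arch_pow[of 2 "L / L' 0"] by auto
    moreover have "L' j = 2 ^ j * L' 0" by (induction j) (simp_all add: L'_Suc)
    ultimately have "L \<le> L' j" using L'_pos[of 0] by (simp add: field_simps)
    then show False using none large by blast
  qed
  then have acc: "acc (i k)" and failed: "\<forall>m<i k. \<not> acc m"
    unfolding ik by (auto intro: LeastI_ex dest: not_less_Least)
  show "M (Suc k) \<le> 2 * L"
  \<comment> \<open>With \<open>i k = 0\<close> the constant is half of \<open>M k\<close>.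
    Otherwise the preceding trial was rejected, so its constant was below \<open>L\<close>, and it
    doubled once.\<close>
  proof (cases "i k")
    case 0
    then show ?thesis using new(1) Mk by (simp add: L'_def)
  next
    case (Suc j)
    then have "\<not> L \<le> L' j" using large[of j] failed by auto
    then show ?thesis by (simp add: new(1) Suc L'_Suc)
  qed
  show "M (Suc k) = 2 powi (int (i k) - 1) * M k" by (simp add: new L'_def)
  show "0 < M (Suc k)" "0 < \<alpha> (Suc k)" "A (Suc k) = A k + \<alpha> (Suc k)"
    "A (Suc k) = M (Suc k) * (\<alpha> (Suc k))\<^sup>2"
    using L'_pos root by (simp_all add: new A'_def)
  show "y (Suc k) = (\<alpha> (Suc k) *\<^sub>R u k + A k *\<^sub>R x k) /\<^sub>R A (Suc k)"
    "x (Suc k) = (\<alpha> (Suc k) *\<^sub>R u (Suc k) + A k *\<^sub>R x k) /\<^sub>R A (Suc k)"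
    by (simp_all add: new x'_def y'_def)
  show "is_arg_min (\<lambda>v. M (Suc k) * (bregman Q d (u k) v + \<alpha> (Suc k) * \<psi> k v (y (Suc k))))
       (\<lambda>v. v \<in> Q) (u (Suc k))"
    using reached_min[OF failed] by (simp add: new)
  show "x (Suc k) \<in> Q" "y (Suc k) \<in> Q" "u (Suc k) \<in> Q"
    using x'Q[OF failed] y'Q wQ[OF failed] by (simp_all add: new)
  show "fd k (x (Suc k)) \<le> fd k (y (Suc k)) + \<psi> k (x (Suc k)) (y (Suc k))
       + M (Suc k) / 2 * (norm (x (Suc k) - y (Suc k)))\<^sup>2 + \<delta> k"
    using acc by (simp add: new acc_def)
qed

text \<open>The equation \<open>A' = l * a\<^sup>2\<close> is what makes the quadratic term of the
  acceptance test, multiplied by \<open>A'\<close>, equal to half the squared norm of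
  \<open>u' - u\<close>, which \<open>bregman Q d u u'\<close> absorbs. One \<open>\<delta>\<close>
  comes from the test, the other from replacing \<open>g x'\<close> by \<open>f x'\<close>.\<close>

lemma accelerated_descent_step:
  fixes Q :: "'a::real_normed_vector set"
  assumes d: "d differentiable_on Q" "strongly_convex_on Q 1 d"
    and model: "\<And>y. y \<in> Q \<Longrightarrow> inexact_model Q f \<delta> L \<psi> (g y) y"
    and Q: "x \<in> Q" "u \<in> Q" "x' \<in> Q" "y' \<in> Q" "z \<in> Q"
    and pos: "0 \<le> A" "0 < a" "0 < l" and A': "A' = A + a" "A' = l * a\<^sup>2"
    and y': "y' = (a *\<^sub>R u + A *\<^sub>R x) /\<^sub>R A'" and x': "x' = (a *\<^sub>R u' + A *\<^sub>R x) /\<^sub>R A'"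
    and min: "is_arg_min (\<lambda>v. l * (bregman Q d u v + a * \<psi> v y')) (\<lambda>v. v \<in> Q) u'"
    and acc: "g x' \<le> g y' + \<psi> x' y' + l / 2 * (norm (x' - y'))\<^sup>2 + \<delta>"
  shows "A' * (f x' - f z) + bregman Q d u' z \<le> A * (f x - f z) + bregman Q d u z + 2 * \<delta> * A'"
proof -
  have A'pos: "0 < A'" using pos A' by simp
  have u': "u' \<in> Q" using min by (simp add: is_arg_min_def)
  have convex: "convex_on Q (\<lambda>v. \<psi> v y')"
    and lower: "\<And>v. v \<in> Q \<Longrightarrow> g y' + \<psi> v y' \<le> f v"
    using model[OF Q(4)] by (auto simp: inexact_model_def)
  \<comment> \<open>The two means share the term in \<open>x\<close>, so it cancels.\<close>
  have "x' - y' = (a / A') *\<^sub>R (u' - u)"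
    unfolding x' y' by (simp add: scaleR_diff_right[symmetric] divide_inverse mult.commute)
  then have "A' * (l / 2 * (norm (x' - y'))\<^sup>2) = A' * (l / 2 * ((a / A') * norm (u' - u))\<^sup>2)"
    using pos A'pos by simp
  also have "\<dots> = (l * a\<^sup>2) * (norm (u' - u))\<^sup>2 / (2 * A')"
    using A'pos by (simp add: power_mult_distrib power_divide power2_eq_square field_simps)
  also have "\<dots> = (norm (u' - u))\<^sup>2 / 2"
    using A'pos by (simp flip: A'(2))
  also have "\<dots> \<le> bregman Q d u u'"
    by (rule bregman_ge_half_norm_sq[OF d Q(2) u'])
  finally have quad: "A' * (l / 2 * (norm (x' - y'))\<^sup>2) \<le> bregman Q d u u'" .
  have weight: "1 - a / A' = A / A'"
    using A'(1) A'pos by (simp add: field_simps)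
  have x'_eq: "x' = (1 - a / A') *\<^sub>R x + (a / A') *\<^sub>R u'"
    unfolding x' weight by (simp add: scaleR_add_right divide_inverse mult.commute)
  have "\<psi> x' y' \<le> (1 - a / A') * \<psi> x y' + (a / A') * \<psi> u' y'"
    unfolding x'_eq using convex_onD[OF convex, of "a / A'" x u'] Q u' pos A' by simp
  then have "A' * \<psi> x' y' \<le> A' * ((1 - a / A') * \<psi> x y' + (a / A') * \<psi> u' y')"
    using A'pos by (intro mult_left_mono) auto
  also have "\<dots> = A * \<psi> x y' + a * \<psi> u' y'"
    unfolding weight using A'pos by (simp add: distrib_left)
  finally have psi: "A' * \<psi> x' y' \<le> A * \<psi> x y' + a * \<psi> u' y'" .
  have "f x' \<le> g x' + \<delta>"
    using model[OF Q(3)] by (simp add: inexact_model_def)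
  with acc have "A' * f x' \<le> A' * (g y' + \<psi> x' y' + l / 2 * (norm (x' - y'))\<^sup>2 + 2 * \<delta>)"
    using A'pos by (intro mult_left_mono) auto
  also have "\<dots> = A' * g y' + A' * \<psi> x' y' + A' * (l / 2 * (norm (x' - y'))\<^sup>2) + 2 * \<delta> * A'"
    by (simp add: algebra_simps)
  also have "\<dots> \<le> A * (g y' + \<psi> x y') + a * (g y' + \<psi> u' y') + bregman Q d u u' + 2 * \<delta> * A'"
    using quad psi distrib_right[of A a "g y'", folded A'(1)] by (simp add: distrib_left)
  \<comment> \<open>The three-point inequality trades the model value at \<open>u'\<close> for the
    one at \<open>z\<close>; the lower model bound at \<open>x\<close> and \<open>z\<close> then
    brings back \<open>f\<close>.\<close>
  also have "\<dots> \<le> A * (g y' + \<psi> x y') + a * (g y' + \<psi> z y') + bregman Q d u z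
      - bregman Q d u' z + 2 * \<delta> * A'"
    using bregman_three_point[OF d(1) convex Q(2,5) pos(3) less_imp_le[OF pos(2)] min]
    by (simp add: algebra_simps)
  also have "\<dots> \<le> A * f x + a * f z + bregman Q d u z - bregman Q d u' z + 2 * \<delta> * A'"
    using mult_left_mono[OF lower[OF Q(1)] pos(1)]
      mult_left_mono[OF lower[OF Q(5)] less_imp_le[OF pos(2)]] by linarith
  finally show ?thesis using A'(1) by (simp add: algebra_simps)
qed

text \<open>With p and q the old and new square roots, a = (q - p)(q + p) is at most 2 q (q - p),
  and q = sqrt l * a. Cancelling \<open>a\<close> bounds the increment below by 1 / (2 sqrt
  l).\<close>

lemma sqrt_step_growth:
  fixes A a l L :: real
  assumes "0 \<le> A" "0 < a" "A + a = l * a\<^sup>2" "0 < l" "l \<le> 2 * L"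
  shows "sqrt A + 1 / (2 * sqrt (2 * L)) \<le> sqrt (A + a)"
proof -
  let ?p = "sqrt A" and ?q = "sqrt (A + a)"
  have q: "0 < ?q" "?p \<le> ?q" using assms by auto
  have qa: "?q = sqrt l * a" using assms(2,3) by (simp add: real_sqrt_mult)
  have "a = (?q - ?p) * (?q + ?p)"
    using assms(1,2) by (simp add: algebra_simps flip: power2_eq_square)
  also have "\<dots> \<le> (?q - ?p) * (2 * ?q)" using q by (intro mult_left_mono) auto
  also have "\<dots> = (?q - ?p) * (2 * sqrt l) * a" by (simp add: qa)
  finally have "1 \<le> (?q - ?p) * (2 * sqrt l)" using assms(2) by simp
  also have "\<dots> \<le> (?q - ?p) * (2 * sqrt (2 * L))"
    using q assms(5) by (intro mult_left_mono) auto
  finally have "1 / (2 * sqrt (2 * L)) \<le> ?q - ?p"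
    using assms(4,5) by (simp add: divide_le_eq)
  then show ?thesis by simp
qed

theorem theorem7:
  fixes Q B :: "'a::real_normed_vector set" and f d :: "'a \<Rightarrow> real"
    and L L0 R :: real and \<delta> :: "nat \<Rightarrow> real"
    and \<psi> :: "nat \<Rightarrow> 'a \<Rightarrow> 'a \<Rightarrow> real" and fd :: "nat \<Rightarrow> 'a \<Rightarrow> real"
    and x0 xs :: 'a and x y u :: "nat \<Rightarrow> 'a" and \<alpha> A M :: "nat \<Rightarrow> real"
    and i :: "nat \<Rightarrow> nat" and w :: "nat \<Rightarrow> nat \<Rightarrow> 'a" and N :: nat
  assumes finite_dim: "finite B" "span B = UNIV"
    and Q: "convex Q" and f: "convex_on Q f"
    and L: "0 < L" and \<delta>: "\<And>k. 0 \<le> \<delta> k"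
    and model: "\<And>k y. y \<in> Q \<Longrightarrow> inexact_model Q f (\<delta> k) L (\<psi> k) (fd k y) y"
    and d: "convex_on Q d" "d differentiable_on Q" "strongly_convex_on Q 1 d"
    and x0: "x0 \<in> Q" and L0: "0 < L0" "L0 \<le> L"
    and xs: "is_arg_min (bregman Q d x0) (is_arg_min f (\<lambda>v. v \<in> Q)) xs"
    and R: "bregman Q d x0 xs \<le> R\<^sup>2"
    and run: "fast_gradient_run Q d \<delta> \<psi> fd x0 L0 x y u \<alpha> A M i w"
    and N: "1 \<le> N"
  shows "f (x N) - f xs \<le> R\<^sup>2 / A N + 2 * (\<Sum>k<N. \<delta> k * A (Suc k)) / A N
       \<and> R\<^sup>2 / A N + 2 * (\<Sum>k<N. \<delta> k * A (Suc k)) / A N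
           \<le> 8 * L * R\<^sup>2 / (real N + 1)\<^sup>2 + 2 * (\<Sum>k<N. \<delta> k * A (Suc k)) / A N
       \<and> (\<forall>k\<ge>1. A k \<ge> (real k + 1)\<^sup>2 / (8 * L))
       \<and> real (\<Sum>k<N. i k + 1) \<le> 4 * real N + log 2 (L / L0)"
proof -

  \<comment> \<open>The whole run: invariants, convergence rate, number of trials\<close>
  have init: "x 0 = x0" "u 0 = x0" "A 0 = 0" "M 0 = L0"
    using run by (simp_all add: fast_gradient_run_def)
  have xsQ: "xs \<in> Q" using xs by (simp add: is_arg_min_def)
  \<comment> \<open>These are the state-dependent hypotheses of \<open>fast_gradient_step\<close>,
    carried together because each iteration needs all of them.\<close>
  have inv: "x k \<in> Q \<and> u k \<in> Q \<and> 0 \<le> A k \<and> 0 < M k \<and> M k \<le> 2 * L" for k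
  proof (induction k)
    case 0
    then show ?case using init x0 L0 by simp
  next
    case (Suc k)
    then show ?case
      using fast_gradient_step[OF run Q model, of k] by (auto simp: less_imp_le)
  qed
  then have inv': "x k \<in> Q" "u k \<in> Q" "0 \<le> A k" "0 < M k" "M k \<le> 2 * L" for k by blast+
  note step = fast_gradient_step[OF run Q model inv']
  have bregman_nonneg: "0 \<le> bregman Q d v xs" if "v \<in> Q" for v
    by (rule order_trans[OF _ bregman_ge_half_norm_sq[OF d(2,3) that xsQ]]) simp
  \<comment> \<open>Since \<open>A 0 = 0\<close>, the potential starts at
    \<open>bregman Q d x0 xs\<close> alone.\<close>
  have descent: "A n * (f (x n) - f xs) + bregman Q d (u n) xs
      \<le> bregman Q d x0 xs + 2 * (\<Sum>k<n. \<delta> k * A (Suc k))" for n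
  proof (induction n)
    case 0
    then show ?case by (simp add: init)
  next
    case (Suc n)
    have "A (Suc n) * (f (x (Suc n)) - f xs) + bregman Q d (u (Suc n)) xs
        \<le> A n * (f (x n) - f xs) + bregman Q d (u n) xs + 2 * \<delta> n * A (Suc n)"
      by (rule accelerated_descent_step[OF d(2,3) model inv'(1,2) step(10,11) xsQ inv'(3)
            step(4,2,5,6,7,8,9,13)])
    with Suc.IH show ?case by (simp add: algebra_simps)
  qed
  have A_growth: "(real (Suc k) + 1)\<^sup>2 / (8 * L) \<le> A (Suc k)" for k
  proof -
    let ?c = "1 / (2 * sqrt (2 * L))"
    have inc: "sqrt (A j) + ?c \<le> sqrt (A (Suc j))" for j
      using sqrt_step_growth[OF inv'(3)[of j] step(4)[of j], of "M (Suc j)" L] step(2,3,5,6)[of j] by simp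
    have "(real (Suc k) + 1) * ?c \<le> sqrt (A (Suc k))"
    proof (induction k)
      case 0
      \<comment> \<open>The first iteration starts from \<open>A 0 = 0\<close>, so
        \<open>M 1 * A 1 = 1\<close> and \<open>sqrt (A 1)\<close> is at least twice
        \<open>?c\<close>. This double gain is why the bound has k + 1 in place of k.\<close>
      have A1: "A 1 = \<alpha> 1" "\<alpha> 1 = M 1 * (\<alpha> 1)\<^sup>2"
        using step(5,6)[of 0] init by simp_all
      then have "M 1 * A 1 = 1" using step(4)[of 0] by (simp add: power2_eq_square)
      then have "1 \<le> 2 * L * A 1"
        using mult_right_mono[OF inv'(5)[of 1] inv'(3)[of 1]] by simp
      then have "1 \<le> sqrt (2 * L) * sqrt (A 1)" by (simp flip: real_sqrt_mult)
      then show ?case using L by (simp add: field_simps)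
    next
      case (Suc k)
      then show ?case using inc[of "Suc k"] by (simp add: algebra_simps add_divide_distrib)
    qed
    \<comment> \<open>The square of \<open>?c\<close> is 1 / (8 L).\<close>
    then have "((real (Suc k) + 1) * ?c)\<^sup>2 \<le> (sqrt (A (Suc k)))\<^sup>2"
      using L by (intro power_mono) auto
    then show ?thesis
      using L inv'(3)[of "Suc k"] by (simp add: power_mult_distrib power_divide)
  qed
  have A_lower: "(real k + 1)\<^sup>2 / (8 * L) \<le> A k" if "k \<ge> 1" for k
    using A_growth[of "k - 1"] that by simp
  have AN: "0 < A N" using L by (intro less_le_trans[OF _ A_lower[OF N]]) simp
  \<comment> \<open>The remaining divergence at \<open>u N\<close> is nonnegative and is
    dropped.\<close>
  have "A N * (f (x N) - f xs) \<le> R\<^sup>2 + 2 * (\<Sum>k<N. \<delta> k * A (Suc k))"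
    using descent[of N] bregman_nonneg[OF inv'(2)[of N]] R by linarith
  then have "f (x N) - f xs \<le> (R\<^sup>2 + 2 * (\<Sum>k<N. \<delta> k * A (Suc k))) / A N"
    using AN by (simp add: le_divide_eq mult.commute)
  then have rate: "f (x N) - f xs \<le> R\<^sup>2 / A N + 2 * (\<Sum>k<N. \<delta> k * A (Suc k)) / A N"
    by (simp add: add_divide_distrib)
  have "R\<^sup>2 / A N \<le> R\<^sup>2 / ((real N + 1)\<^sup>2 / (8 * L))"
    using A_lower[OF N] L by (intro divide_left_mono) (auto intro!: mult_pos_pos AN divide_pos_pos)
  then have bound: "R\<^sup>2 / A N \<le> 8 * L * R\<^sup>2 / (real N + 1)\<^sup>2"
    by (simp add: mult.commute)
  have trials: "real (\<Sum>k<n. i k + 1) = 2 * real n + log 2 (M n / L0)" for n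
  proof (induction n)
    case 0
    then show ?case using init L0 by simp
  next
    case (Suc n)
    have "M (Suc n) / L0 = 2 powr (real (i n) - 1) * (M n / L0)"
      using step(1)[of n] powr_real_of_int'[of 2 "int (i n) - 1"] by simp
    then have "log 2 (M (Suc n) / L0) = real (i n) - 1 + log 2 (M n / L0)"
      using inv'(4)[of n] L0 by (simp only: log_mult log_powr_cancel) simp
    with Suc.IH show ?case by simp
  qed
  \<comment> \<open>From \<open>M N \<le> 2 * L\<close> the count is at most 2 N + 1 + log 2 (L /
    L0); the extra 1 fits into 4 N because N is at least 1.\<close>
  have "log 2 (M N / L0) \<le> log 2 (2 * (L / L0))"
    using inv'(4,5)[of N] L0 L by (simp add: divide_right_mono)
  also have "\<dots> = 1 + log 2 (L / L0)"
    using L L0 by (simp only: log_mult) simp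
  finally have "real (\<Sum>k<N. i k + 1) \<le> 4 * real N + log 2 (L / L0)"
    using trials[of N] N by simp
  with rate bound A_lower show ?thesis by simp
qed

end
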